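(* Let $n\ge1$ be an integer, let $(X,\mu)$ be a finite measure space, and for $1\le i\le n$ let $P_i=p_i\mu$, $Q_i=q_i\mu$ be probability measures on $X$, absolutely continuous with respect to $\mu$, with densities $p_i,q_i$ nonzero $\mu$-a.e. Let $f_i:(0,\infty)\to\mathbb{R}^+$, $1\le i\le n$, each be either convex or concave. Write $\vec{\mathbf f}=(f_1,\dots,f_n)$, $\vec{\mathbf P}=(P_1,\dots,P_n)$, $\vec{\mathbf Q}=(Q_1,\dots,Q_n)$. Then $D_{\vec{\mathbf f}}(\vec{\mathbf P},\vec{\mathbf Q})+D_{\vec{\mathbf f}^*}(\vec{\mathbf P},\vec{\mathbf Q})$ is symmetric in $\vec{\mathbf P}$ and $\vec{\mathbf Q}$, namely, $$D_{\vec{\mathbf f}}(\vec{\mathbf P},\vec{\mathbf Q})+D_{\vec{\mathbf f}^*}(\vec{\mathbf P},\vec{\mathbf Q})=D_{\vec{\mathbf f}}(\vec{\mathbf Q},\vec{\mathbf P})+D_{\vec{\mathbf f}^*}(\vec{\mathbf Q},\vec{\mathbf P}).$$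
   Context: $\mathbb{R}^+=\{x\in\mathbb{R}:x\ge 0\}$. Convention: $0\cdot\infty=0$. The $*$-adjoint of $f:(0,\infty)\to\mathbb{R}^+$ is $f^*(t)=t f(1/t)$, $t>0$; and $\vec{\mathbf f}^*=(f_1^*,\dots,f_n^* )$. Mixed $f$-divergence: $$D_{\vec{\mathbf f}}(\vec{\mathbf P},\vec{\mathbf Q})=\int_X\prod_{i=1}^n\left[f_i\left(\frac{p_i}{q_i}\right)q_i\right]^{1/n}d\mu ,\qquad D_{\vec{\mathbf f}}(\vec{\mathbf Q},\vec{\mathbf P})=\int_X\prod_{i=1}^n\left[f_i\left(\frac{q_i}{p_i}\right)p_i\right]^{1/n}d\mu .$$ *)

theory Defs
  imports "HOL-Probability.Probability"
begin

definition star_adjoint :: "(real \<Rightarrow> real) \<Rightarrow> real \<Rightarrow> real" where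
  "star_adjoint f t = t * f (1 / t)"

text \<open>
  A real-valued version of the density of \<open>N\<close> with respect to \<open>M\<close>. It is determined only up to
  \<open>M\<close>-null sets, which does not affect the integral below; see
  \<open>mixed_f_divergence_density\<close>.
\<close>

definition real_density :: "'a measure \<Rightarrow> 'a measure \<Rightarrow> 'a \<Rightarrow> real" where
  "real_density M N x = enn2real (RN_deriv M N x)"

text \<open>
  The integral of the nonnegative integrand may be infinite, hence the value in \<^typ>\<open>ennreal\<close>.
  Vectors indexed by \<open>1, \<dots>, n\<close> are functions on \<^typ>\<open>nat\<close> of which only the values on
  \<open>{1..n}\<close> are used. Values of \<open>f i\<close> outside of \<open>(0, \<infinity>)\<close> are irrelevant as long as the densities
  are nonzero almost everywhere.
\<close>

definition mixed_f_divergence ::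
  "'a measure \<Rightarrow> nat \<Rightarrow> (nat \<Rightarrow> real \<Rightarrow> real) \<Rightarrow> (nat \<Rightarrow> 'a measure) \<Rightarrow> (nat \<Rightarrow> 'a measure) \<Rightarrow> ennreal"
where
  "mixed_f_divergence M n f P Q =
     (\<integral>\<^sup>+x. ennreal (\<Prod>i=1..n.
        (f i (real_density M (P i) x / real_density M (Q i) x) * real_density M (Q i) x)
          powr (1 / real n)) \<partial>M)"

lemma AE_real_density_eq:
  assumes "finite_measure M" "p \<in> borel_measurable M" "AE x in M. 0 \<le> p x"
  shows "AE x in M. real_density M (density M (\<lambda>x. ennreal (p x))) x = p x"
proof -
  interpret finite_measure M by fact
  have "AE x in M. ennreal (p x) = RN_deriv M (density M (\<lambda>x. ennreal (p x))) x"
    by (rule RN_deriv_unique) (use assms in auto)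
  with assms(3) show ?thesis
    by eventually_elim (metis real_density_def enn2real_ennreal)
qed

lemma mixed_f_divergence_density:
  fixes p q :: "nat \<Rightarrow> 'a \<Rightarrow> real"
  assumes "finite_measure M"
    and "\<And>i. i \<in> {1..n} \<Longrightarrow> p i \<in> borel_measurable M \<and> (AE x in M. 0 \<le> p i x)"
    and "\<And>i. i \<in> {1..n} \<Longrightarrow> q i \<in> borel_measurable M \<and> (AE x in M. 0 \<le> q i x)"
    and "\<And>i. i \<in> {1..n} \<Longrightarrow> P i = density M (\<lambda>x. ennreal (p i x))"
    and "\<And>i. i \<in> {1..n} \<Longrightarrow> Q i = density M (\<lambda>x. ennreal (q i x))"
  shows "mixed_f_divergence M n f P Q =
    (\<integral>\<^sup>+x. ennreal (\<Prod>i=1..n. (f i (p i x / q i x) * q i x) powr (1 / real n)) \<partial>M)"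
proof -
  have "AE x in M. \<forall>i\<in>{1..n}. real_density M (P i) x = p i x"
  proof (rule AE_finite_allI)
    fix i assume i: "i \<in> {1..n}"
    show "AE x in M. real_density M (P i) x = p i x"
      unfolding assms(4)[OF i]
      using assms(1) assms(2)[OF i] AE_real_density_eq by blast
  qed simp
  moreover have "AE x in M. \<forall>i\<in>{1..n}. real_density M (Q i) x = q i x"
  proof (rule AE_finite_allI)
    fix i assume i: "i \<in> {1..n}"
    show "AE x in M. real_density M (Q i) x = q i x"
      unfolding assms(5)[OF i]
      using assms(1) assms(3)[OF i] AE_real_density_eq by blast
  qed simp
  ultimately show ?thesis
    unfolding mixed_f_divergence_def
    by (intro nn_integral_cong_AE, eventually_elim)
       (intro arg_cong[where f = ennreal] prod.cong, auto)
qed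

end

theory Submission
  imports Defs
begin

text \<open>
  The adjoint is built so that \<open>q * f\<^sup>*(p / q) = p * f(q / p)\<close>: the factor \<open>t = p / q\<close> turns the
  weight \<open>q\<close> into \<open>p\<close>, and the reciprocal turns the likelihood ratio upside down. Hence passing
  to the adjoints amounts to exchanging the two vectors of measures in the integrand
  (\<open>mixed_f_divergence_star_adjoint\<close>), so both sides of the theorem have the same two
  summands, in opposite order. The identity of integrands is pointwise, so infinite values of
  the integrals cause no trouble.
\<close>

lemma star_adjoint_divide_mult:
  assumes "q \<noteq> 0"
  shows "star_adjoint f (p / q) * q = f (q / p) * p"
  using assms by (simp add: star_adjoint_def)

text \<open>
  The identity of integrands needs a nonzero denominator, which holds almost everywhere
  simultaneously for the finitely many indices.
\<close>

lemma mixed_f_divergence_star_adjoint: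
  fixes p q :: "nat \<Rightarrow> 'a \<Rightarrow> real"
  assumes "finite_measure M"
    and p: "\<And>i. i \<in> {1..n} \<Longrightarrow> p i \<in> borel_measurable M \<and> (AE x in M. 0 \<le> p i x)"
    and q: "\<And>i. i \<in> {1..n} \<Longrightarrow> q i \<in> borel_measurable M \<and> (AE x in M. 0 \<le> q i x)"
    and P: "\<And>i. i \<in> {1..n} \<Longrightarrow> P i = density M (\<lambda>x. ennreal (p i x))"
    and Q: "\<And>i. i \<in> {1..n} \<Longrightarrow> Q i = density M (\<lambda>x. ennreal (q i x))"
    and q_nonzero: "\<And>i. i \<in> {1..n} \<Longrightarrow> AE x in M. q i x \<noteq> 0"
  shows "mixed_f_divergence M n (\<lambda>i. star_adjoint (f i)) P Q = mixed_f_divergence M n f Q P"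
proof -
  have "AE x in M. \<forall>i\<in>{1..n}. q i x \<noteq> 0"
    by (rule AE_finite_allI) (use q_nonzero in auto)
  then have "(\<integral>\<^sup>+x. ennreal (\<Prod>i=1..n.
        (star_adjoint (f i) (p i x / q i x) * q i x) powr (1 / real n)) \<partial>M)
      = (\<integral>\<^sup>+x. ennreal (\<Prod>i=1..n. (f i (q i x / p i x) * p i x) powr (1 / real n)) \<partial>M)"
    by (intro nn_integral_cong_AE, eventually_elim)
       (intro arg_cong[where f = ennreal] prod.cong, auto simp: star_adjoint_divide_mult)
  moreover have "mixed_f_divergence M n (\<lambda>i. star_adjoint (f i)) P Q
      = (\<integral>\<^sup>+x. ennreal (\<Prod>i=1..n.
          (star_adjoint (f i) (p i x / q i x) * q i x) powr (1 / real n)) \<partial>M)"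
    by (rule mixed_f_divergence_density) (fact assms)+
  moreover have "mixed_f_divergence M n f Q P
      = (\<integral>\<^sup>+x. ennreal (\<Prod>i=1..n. (f i (q i x / p i x) * p i x) powr (1 / real n)) \<partial>M)"
    by (rule mixed_f_divergence_density) (fact assms)+
  ultimately show ?thesis
    by simp
qed

theorem proposition2p3:
  fixes n :: nat
    and M :: "'a measure"
    and P Q :: "nat \<Rightarrow> 'a measure"
    and p q :: "nat \<Rightarrow> 'a \<Rightarrow> real"
    and f :: "nat \<Rightarrow> real \<Rightarrow> real"
  assumes "n \<ge> 1"
    and "finite_measure M"
    and "\<And>i. i \<in> {1..n} \<Longrightarrow> p i \<in> borel_measurable M"
    and "\<And>i. i \<in> {1..n} \<Longrightarrow> q i \<in> borel_measurable M"
    and "\<And>i. i \<in> {1..n} \<Longrightarrow> AE x in M. 0 \<le> p i x"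
    and "\<And>i. i \<in> {1..n} \<Longrightarrow> AE x in M. 0 \<le> q i x"
    and "\<And>i. i \<in> {1..n} \<Longrightarrow> P i = density M (\<lambda>x. ennreal (p i x))"
    and "\<And>i. i \<in> {1..n} \<Longrightarrow> Q i = density M (\<lambda>x. ennreal (q i x))"
    and "\<And>i. i \<in> {1..n} \<Longrightarrow> prob_space (P i)"
    and "\<And>i. i \<in> {1..n} \<Longrightarrow> prob_space (Q i)"
    and "\<And>i. i \<in> {1..n} \<Longrightarrow> AE x in M. p i x \<noteq> 0"
    and "\<And>i. i \<in> {1..n} \<Longrightarrow> AE x in M. q i x \<noteq> 0"
    and "\<And>i t. i \<in> {1..n} \<Longrightarrow> t > 0 \<Longrightarrow> f i t \<ge> 0"
    and "\<And>i. i \<in> {1..n} \<Longrightarrow> convex_on {0<..} (f i) \<or> concave_on {0<..} (f i)"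
  shows "mixed_f_divergence M n f P Q + mixed_f_divergence M n (\<lambda>i. star_adjoint (f i)) P Q
       = mixed_f_divergence M n f Q P + mixed_f_divergence M n (\<lambda>i. star_adjoint (f i)) Q P"
proof -
  have "mixed_f_divergence M n (\<lambda>i. star_adjoint (f i)) P Q = mixed_f_divergence M n f Q P"
    by (rule mixed_f_divergence_star_adjoint[where p = p and q = q]) (use assms in auto)
  moreover have "mixed_f_divergence M n (\<lambda>i. star_adjoint (f i)) Q P = mixed_f_divergence M n f P Q"
    by (rule mixed_f_divergence_star_adjoint[where p = q and q = p]) (use assms in auto)
  ultimately show ?thesis
    by (simp add: add.commute)
qed

end
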